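(* Let $\mathcal{T}\in\mathbb{R}^{I\times J\times K}$, $R\ge1$. Let $\mathbf{M}=\bar{\mathbf{V}}\mathbf{S}\bar{\mathbf{V}}^T$ with $\bar{\mathbf{V}}\in\mathbb{R}^{JK\times JK}$ orthogonal with columns $\bar{\mathbf{v}}_i$ and $\mathbf{S}=\mathrm{diag}(\lambda_1,\dots,\lambda_{JK})$, and let $\bar{\mathbf{V}}_i\in\mathbb{R}^{J\times K}$ be the matricization of $\bar{\mathbf{v}}_i$. For $\mathbf{B}\in\mathbb{R}^{J\times R}$, $\mathbf{C}\in\mathbb{R}^{K\times R}$ define $$\mathfrak{L}(\mathbf{B},\mathbf{C}):=\inf_{\mathbf{X}\in\mathrm{KR}(\mathbf{B},\mathbf{C})}\frac12\sum_{i=1}^{JK}\lambda_i\|\bar{\mathbf{V}}_i-\mathbf{X}\|_F^2 .$$ Then $$\inf_{\mathbf{B},\mathbf{C}}\mathfrak{J}_{red}(\mathbf{B},\mathbf{C})\le\inf_{\mathbf{B},\mathbf{C}}\mathfrak{L}(\mathbf{B},\mathbf{C}).$$ Moreover, $$\inf_{\mathbf{B},\mathbf{C}}\mathfrak{L}(\mathbf{B},\mathbf{C})=\inf_{\mathrm{rank}(\mathbf{X})\le R}\frac12\sum_{i=1}^{JK}\lambda_i\|\bar{\mathbf{V}}_i-\mathbf{X}\|_F^2,$$ where the last infimum is over $\mathbf{X}\in\mathbb{R}^{J\times K}$.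
   Context: $I,J,K,R$ are positive integers. For $\mathbf{A}\in\mathbb{R}^{I\times R}$, $\mathbf{B}\in\mathbb{R}^{J\times R}$, $\mathbf{C}\in\mathbb{R}^{K\times R}$ with entries $a_{ir},b_{jr},c_{kr}$, put $$\mathfrak{J}(\mathbf{A},\mathbf{B},\mathbf{C})=\tfrac12\sum_{i,j,k}\Big(\mathcal{T}_{ijk}-\sum_{r=1}^R a_{ir}b_{jr}c_{kr}\Big)^2,\qquad \mathfrak{J}_{red}(\mathbf{B},\mathbf{C})=\min_{\mathbf{A}\in\mathbb{R}^{I\times R}}\mathfrak{J}(\mathbf{A},\mathbf{B},\mathbf{C}).$$ $\mathbf{M}\in\mathbb{R}^{JK\times JK}$ is the symmetric matrix whose entry at row $\alpha+(\beta-1)J$ and column $\gamma+(\delta-1)J$ is $\sum_{i=1}^I\mathcal{T}_{i\alpha\beta}\mathcal{T}_{i\gamma\delta}$, for $1\le\alpha,\gamma\le J$, $1\le\beta,\delta\le K$. The matricization of $\mathbf{v}\in\mathbb{R}^{JK}$ is the $J\times K$ matrix whose $(j,k)$ entry is the entry of $\mathbf{v}$ at position $j+(k-1)J$. The Khatri-Rao range is $\mathrm{KR}(\mathbf{B},\mathbf{C})=\{\sum_{r=1}^R\mu_r\,\mathbf{b}_r\circ\mathbf{c}_r\in\mathbb{R}^{J\times K}:\mu_r\in\mathbb{R}\}$, where $\mathbf{b}_r,\mathbf{c}_r$ are the columns of $\mathbf{B},\mathbf{C}$ and $(\mathbf{b}\circ\mathbf{c})_{jk}=b_jc_k$. $\|\cdot\|_F$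 is the Frobenius norm. *)

theory Defs
  imports "HOL-Analysis.Analysis"
begin

text \<open>
  The dimensions \<open>I\<close>, \<open>J\<close>, \<open>K\<close>, \<open>R\<close> are the cardinalities of the finite index types
  \<open>'i\<close>, \<open>'j\<close>, \<open>'k\<close>, \<open>'r\<close>; a tensor entry is \<open>T $ i $ j $ k\<close>.  The \<open>J K\<close> positions of a
  vectorized matrix are indexed by \<open>'j \<times> 'k\<close>: the pair \<open>(j, k)\<close> stands for the position
  \<open>j + (k - 1) J\<close>.
\<close>

definition cp_cost ::
  "real^'k^'j^'i \<Rightarrow> real^'r^'i \<Rightarrow> real^'r^'j \<Rightarrow> real^'r^'k \<Rightarrow> real" where
  "cp_cost T A B C =
     1/2 * (\<Sum>i\<in>UNIV. \<Sum>j\<in>UNIV. \<Sum>k\<in>UNIV.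
       (T $ i $ j $ k - (\<Sum>r\<in>UNIV. A $ i $ r * B $ j $ r * C $ k $ r))\<^sup>2)"

text \<open>
  \<open>LEAST\<close> denotes an attained minimum.  It exists here, since minimizing over \<open>A\<close> is a
  linear least-squares problem.
\<close>

definition cp_cost_red ::
  "real^'k^'j^'i \<Rightarrow> real^'r^'j \<Rightarrow> real^'r^'k \<Rightarrow> real" where
  "cp_cost_red T B C = (LEAST m. m \<in> range (\<lambda>A. cp_cost T A B C))"

definition slice_gram :: "real^'k^'j^'i \<Rightarrow> real^('j \<times> 'k)^('j \<times> 'k)" where
  "slice_gram T =
     (\<chi> p q. \<Sum>i\<in>UNIV. T $ i $ fst p $ snd p * T $ i $ fst q $ snd q)"

definition matricize :: "real^('j \<times> 'k) \<Rightarrow> real^'k^'j" where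
  "matricize v = (\<chi> j k. v $ (j, k))"

definition diag_matrix :: "('n \<Rightarrow> real) \<Rightarrow> real^'n^'n" where
  "diag_matrix d = (\<chi> p q. if p = q then d p else 0)"

definition outer :: "real^'j \<Rightarrow> real^'k \<Rightarrow> real^'k^'j" where
  "outer b c = (\<chi> j k. b $ j * c $ k)"

definition khatri_rao_range :: "real^'r^'j \<Rightarrow> real^'r^'k \<Rightarrow> (real^'k^'j) set" where
  "khatri_rao_range B C =
     range (\<lambda>\<mu> :: 'r \<Rightarrow> real. \<Sum>r\<in>UNIV. \<mu> r *\<^sub>R outer (column r B) (column r C))"

text \<open>
  The library norm on \<^typ>\<open>real^'k^'j\<close> is the Frobenius norm.
\<close>

definition weighted_dist ::
  "('j \<times> 'k \<Rightarrow> real) \<Rightarrow> real^('j \<times> 'k)^('j \<times> 'k) \<Rightarrow> real^'k^'j \<Rightarrow> real" where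
  "weighted_dist lam V X =
     1/2 * (\<Sum>p\<in>UNIV. lam p * (norm (matricize (column p V) - X))\<^sup>2)"

text \<open>
  The real-valued infimum is meaningful only when \<open>weighted_dist lam V\<close> is bounded below on the
  range.  This holds when \<open>lam\<close> lists the eigenvalues of a matrix \<open>slice_gram T\<close>, which is
  positive semidefinite, so that \<open>weighted_dist lam V X \<ge> 0\<close>.
\<close>

definition kr_cost ::
  "('j \<times> 'k \<Rightarrow> real) \<Rightarrow> real^('j \<times> 'k)^('j \<times> 'k) \<Rightarrow>
     real^'r^'j \<Rightarrow> real^'r^'k \<Rightarrow> real" where
  "kr_cost lam V B C = (INF X\<in>khatri_rao_range B C. weighted_dist lam V X)"

end

theory Submission imports Defs begin

text \<open>
  The inequality rests on one identity.  Let \<open>t\<^sub>i\<close> be the vectorized slices of \<open>T\<close> and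
  \<open>c\<^sub>i\<^sub>p\<close> the coefficient of \<open>t\<^sub>i\<close> along the \<open>p\<close>-th column \<open>v\<^sub>p\<close> of \<open>V\<close>, so that
  \<open>t\<^sub>i = (\<Sum>p. c\<^sub>i\<^sub>p v\<^sub>p)\<close>.  The spectral decomposition says \<open>(\<Sum>i. c\<^sub>i\<^sub>p c\<^sub>i\<^sub>q) = \<lambda>\<^sub>p\<close> if \<open>p = q\<close>,
  and \<open>0\<close> otherwise.  For a matrix \<open>X\<close>, approximate the \<open>i\<close>-th slice by \<open>s\<^sub>i X\<close>, where
  \<open>s\<^sub>i = (\<Sum>p. c\<^sub>i\<^sub>p)\<close>.  The error is \<open>t\<^sub>i - s\<^sub>i X = (\<Sum>p. c\<^sub>i\<^sub>p (v\<^sub>p - X))\<close>; squaring, summing over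
  \<open>i\<close> and using the relation above leaves exactly \<open>(\<Sum>p. \<lambda>\<^sub>p \<parallel>v\<^sub>p - X\<parallel>\<^sup>2)\<close>.  If \<open>X\<close> lies in the
  Khatri-Rao range of \<open>B\<close> and \<open>C\<close>, so does every \<open>s\<^sub>i X\<close>.  Hence each value of the weighted
  distance on that range is a value of the CP cost for the same \<open>B\<close>, \<open>C\<close>
  (lemma \<open>weighted_dist_eq_cp_cost\<close>), which gives the inequality.  It also shows that the
  weighted distance is nonnegative on every Khatri-Rao range, so that the real-valued infima are
  bounded below.

  The equality of the two infima holds because the Khatri-Rao ranges of all \<open>B\<close>, \<open>C\<close> with
  \<open>R\<close> columns together make up the set of matrices of rank at most \<open>R\<close>
  (lemma \<open>UN_khatri_rao_range\<close>): \<open>X\<close> is in the range of \<open>B\<close>, \<open>C\<close> exactly when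
  \<open>X = B diag(\<mu>) C\<^sup>T\<close> for some \<open>\<mu>\<close>, and every matrix of rank at most \<open>R\<close> is a product of
  factors with \<open>R\<close> columns.
\<close>

section \<open>The reduced cost\<close>

lemma norm_sq_matrix:
  fixes X :: "real^'k^'j"
  shows "(norm X)\<^sup>2 = (\<Sum>j\<in>UNIV. \<Sum>k\<in>UNIV. (X $ j $ k)\<^sup>2)"
  unfolding power2_norm_eq_inner by (simp add: inner_vec_def power2_eq_square)

lemma cp_cost_nonneg: "0 \<le> cp_cost T A B C"
  by (simp add: cp_cost_def sum_nonneg)

text \<open>
  The tensors of the form \<open>\<Sum>r. a\<^sub>r \<circ> b\<^sub>r \<circ> c\<^sub>r\<close> with \<open>B\<close> and \<open>C\<close> fixed form a linear subspace,
  which is closed, so it has a point nearest to \<open>T\<close>.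
\<close>

lemma cp_cost_attains_min:
  fixes T :: "real^'k^'j^'i" and B :: "real^'r^'j" and C :: "real^'r^'k"
  obtains A where "\<And>A'. cp_cost T A B C \<le> cp_cost T A' B C"
proof -
  define F where "F A = (\<chi> i j k. \<Sum>r\<in>UNIV. A $ i $ r * B $ j $ r * C $ k $ r)"
    for A :: "real^'r^'i"
  have cost: "cp_cost T A B C = 1/2 * (dist T (F A))\<^sup>2" for A
    unfolding dist_norm power2_norm_eq_inner
    by (simp add: cp_cost_def F_def inner_vec_def power2_eq_square)
  have "linear F"
    by (rule linearI) (simp_all add: F_def vec_eq_iff algebra_simps sum.distrib sum_distrib_left)
  then have "closed (range F)"
    by (intro closed_subspace linear_subspace_image subspace_UNIV)
  moreover have "range F \<noteq> {}"
    by simp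
  ultimately obtain Y where "Y \<in> range F" and near: "\<And>Z. Z \<in> range F \<Longrightarrow> dist T Y \<le> dist T Z"
    by (rule distance_attains_inf) auto
  then obtain A where "Y = F A"
    by (elim imageE)
  with near have "dist T (F A) \<le> dist T (F A')" for A'
    by simp
  then show ?thesis
    by (intro that[of A]) (simp add: cost)
qed

lemma cp_cost_red_min:
  shows cp_cost_red_le: "cp_cost_red T B C \<le> cp_cost T A B C"
    and cp_cost_red_nonneg: "0 \<le> cp_cost_red T B C"
proof -
  obtain A0 where A0: "\<And>A'. cp_cost T A0 B C \<le> cp_cost T A' B C"
    using cp_cost_attains_min by blast
  have "cp_cost_red T B C = cp_cost T A0 B C"
    unfolding cp_cost_red_def by (rule Least_equality) (use A0 in auto)
  then show "cp_cost_red T B C \<le> cp_cost T A B C" "0 \<le> cp_cost_red T B C"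
    using A0 by (simp_all add: cp_cost_nonneg)
qed

section \<open>The weighted distance as a CP cost\<close>

lemma sum_sq_orthogonal:
  fixes c :: "'i::finite \<Rightarrow> 'p::finite \<Rightarrow> real"
  assumes orth: "\<And>p q. (\<Sum>i\<in>UNIV. c i p * c i q) = (if p = q then l p else 0)"
  shows "(\<Sum>i\<in>UNIV. (\<Sum>p\<in>UNIV. c i p * d p)\<^sup>2) = (\<Sum>p\<in>UNIV. l p * (d p)\<^sup>2)"
proof -
  have "(\<Sum>i\<in>UNIV. (\<Sum>p\<in>UNIV. c i p * d p)\<^sup>2)
      = (\<Sum>i\<in>UNIV. \<Sum>p\<in>UNIV. \<Sum>q\<in>UNIV. c i p * c i q * (d p * d q))"
    by (simp add: power2_eq_square sum_product ac_simps)
  also have "\<dots> = (\<Sum>p\<in>UNIV. \<Sum>i\<in>UNIV. \<Sum>q\<in>UNIV. c i p * c i q * (d p * d q))"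
    by (rule sum.swap)
  also have "\<dots> = (\<Sum>p\<in>UNIV. \<Sum>q\<in>UNIV. (\<Sum>i\<in>UNIV. c i p * c i q) * (d p * d q))"
    by (intro sum.cong refl, subst sum.swap) (simp add: sum_distrib_right)
  also have "\<dots> = (\<Sum>p\<in>UNIV. \<Sum>q\<in>UNIV. if q = p then l p * (d p)\<^sup>2 else 0)"
    unfolding orth by (intro sum.cong refl) (auto simp: power2_eq_square)
  finally show ?thesis by simp
qed

text \<open>
  Row \<open>i\<close> of \<open>c\<close> lists the coefficients of the \<open>i\<close>-th slice of \<open>T\<close> along the columns of \<open>V\<close>.
  With the slices as rows of a matrix \<open>G\<close>, the coefficients are \<open>c = G V\<close>; as \<open>slice_gram T\<close> is
  \<open>G\<^sup>T G\<close>, the matrix \<open>c\<^sup>T c\<close> is diagonal.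
\<close>

lemma slice_coefficients:
  fixes T :: "real^'k^'j^'i" and V :: "real^('j \<times> 'k)^('j \<times> 'k)"
  assumes V: "orthogonal_matrix V"
    and gram: "slice_gram T = V ** diag_matrix lam ** transpose V"
  obtains c :: "real^('j \<times> 'k)^'i" where
    "\<And>i j k. T $ i $ j $ k = (\<Sum>p\<in>UNIV. c $ i $ p * V $ (j, k) $ p)"
    "\<And>p q. (\<Sum>i\<in>UNIV. c $ i $ p * c $ i $ q) = (if p = q then lam p else 0)"
proof -
  define G :: "real^('j \<times> 'k)^'i" where "G = (\<chi> i p. T $ i $ fst p $ snd p)"
  define c where "c = G ** V"
  have VV: "V ** transpose V = mat 1" "transpose V ** V = mat 1"
    using V by (auto simp: orthogonal_matrix_def)
  have "slice_gram T = transpose G ** G"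
    by (simp add: slice_gram_def G_def matrix_matrix_mult_def transpose_def)
  then have "transpose c ** c = transpose V ** (V ** diag_matrix lam ** transpose V) ** V"
    unfolding gram c_def by (simp add: matrix_transpose_mul matrix_mul_assoc)
  also have "\<dots> = (transpose V ** V) ** diag_matrix lam ** (transpose V ** V)"
    by (simp add: matrix_mul_assoc)
  also have "\<dots> = diag_matrix lam"
    by (simp add: VV)
  finally have cc: "transpose c ** c = diag_matrix lam" .
  have "(\<Sum>i\<in>UNIV. c $ i $ p * c $ i $ q) = (transpose c ** c) $ p $ q" for p q
    by (simp add: matrix_matrix_mult_def transpose_def)
  then have orth: "(\<Sum>i\<in>UNIV. c $ i $ p * c $ i $ q) = (if p = q then lam p else 0)" for p q
    unfolding cc by (simp add: diag_matrix_def)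
  have "G = c ** transpose V"
    by (simp add: c_def matrix_mul_assoc[symmetric] VV)
  then have "G $ i $ q = (\<Sum>p\<in>UNIV. c $ i $ p * V $ q $ p)" for i q
    by (simp add: matrix_matrix_mult_def transpose_def)
  from this[of _ "(_, _)"]
  have "T $ i $ j $ k = (\<Sum>p\<in>UNIV. c $ i $ p * V $ (j, k) $ p)" for i j k
    by (simp add: G_def)
  with orth show ?thesis by (rule that[rotated])
qed

lemma weighted_dist_eq_cp_cost:
  fixes T :: "real^'k^'j^'i" and V :: "real^('j \<times> 'k)^('j \<times> 'k)"
    and B :: "real^'r^'j" and C :: "real^'r^'k"
  assumes V: "orthogonal_matrix V"
    and gram: "slice_gram T = V ** diag_matrix lam ** transpose V"
    and X: "X \<in> khatri_rao_range B C"
  obtains A where "weighted_dist lam V X = cp_cost T A B C"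
proof -
  obtain c :: "real^('j \<times> 'k)^'i" where
    T: "\<And>i j k. T $ i $ j $ k = (\<Sum>p\<in>UNIV. c $ i $ p * V $ (j, k) $ p)" and
    orth: "\<And>p q. (\<Sum>i\<in>UNIV. c $ i $ p * c $ i $ q) = (if p = q then lam p else 0)"
    using slice_coefficients[OF V gram] by blast
  obtain \<mu> :: "'r \<Rightarrow> real"
    where "X = (\<Sum>r\<in>UNIV. \<mu> r *\<^sub>R outer (column r B) (column r C))"
    using X by (auto simp: khatri_rao_range_def)
  then have X_entry: "X $ j $ k = (\<Sum>r\<in>UNIV. \<mu> r * B $ j $ r * C $ k $ r)" for j k
    by (simp add: outer_def column_def mult.assoc)
  \<comment> \<open>The \<open>i\<close>-th slice is approximated by \<open>X\<close> times the sum of its coefficients.\<close>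
  define A :: "real^'r^'i" where "A = (\<chi> i r. (\<Sum>p\<in>UNIV. c $ i $ p) * \<mu> r)"
  have "T $ i $ j $ k - (\<Sum>r\<in>UNIV. A $ i $ r * B $ j $ r * C $ k $ r)
      = (\<Sum>p\<in>UNIV. c $ i $ p * (V $ (j, k) $ p - X $ j $ k))" for i j k
  proof -
    have "(\<Sum>r\<in>UNIV. A $ i $ r * B $ j $ r * C $ k $ r) = (\<Sum>p\<in>UNIV. c $ i $ p) * X $ j $ k"
      unfolding X_entry sum_distrib_left[of _ _ UNIV] by (simp add: A_def mult.assoc)
    then show ?thesis
      by (simp add: T right_diff_distrib sum_subtractf sum_distrib_right)
  qed
  then have "cp_cost T A B C
      = 1/2 * (\<Sum>i\<in>UNIV. \<Sum>j\<in>UNIV. \<Sum>k\<in>UNIV.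
          (\<Sum>p\<in>UNIV. c $ i $ p * (V $ (j, k) $ p - X $ j $ k))\<^sup>2)"
    by (simp add: cp_cost_def)
  also have "\<dots> = 1/2 * (\<Sum>j\<in>UNIV. \<Sum>i\<in>UNIV. \<Sum>k\<in>UNIV.
          (\<Sum>p\<in>UNIV. c $ i $ p * (V $ (j, k) $ p - X $ j $ k))\<^sup>2)"
    by (simp only: sum.swap[of _ "UNIV :: 'j set" "UNIV :: 'i set"])
  also have "\<dots> = 1/2 * (\<Sum>j\<in>UNIV. \<Sum>k\<in>UNIV. \<Sum>i\<in>UNIV.
          (\<Sum>p\<in>UNIV. c $ i $ p * (V $ (j, k) $ p - X $ j $ k))\<^sup>2)"
    by (simp only: sum.swap[of _ "UNIV :: 'k set" "UNIV :: 'i set"])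
  also have "\<dots> = 1/2 * (\<Sum>j\<in>UNIV. \<Sum>k\<in>UNIV. \<Sum>p\<in>UNIV. lam p * (V $ (j, k) $ p - X $ j $ k)\<^sup>2)"
    by (simp only: sum_sq_orthogonal[OF orth])
  also have "\<dots> = 1/2 * (\<Sum>j\<in>UNIV. \<Sum>p\<in>UNIV. \<Sum>k\<in>UNIV. lam p * (V $ (j, k) $ p - X $ j $ k)\<^sup>2)"
    by (simp only: sum.swap[of _ "UNIV :: ('j \<times> 'k) set" "UNIV :: 'k set"])
  also have "\<dots> = 1/2 * (\<Sum>p\<in>UNIV. \<Sum>j\<in>UNIV. \<Sum>k\<in>UNIV. lam p * (V $ (j, k) $ p - X $ j $ k)\<^sup>2)"
    by (simp only: sum.swap[of _ "UNIV :: ('j \<times> 'k) set" "UNIV :: 'j set"])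
  also have "\<dots> = weighted_dist lam V X"
    by (simp add: weighted_dist_def norm_sq_matrix matricize_def column_def sum_distrib_left)
  finally show ?thesis by (intro that[of A]) simp
qed

section \<open>Khatri-Rao ranges and matrices of bounded rank\<close>

lemma khatri_rao_range_eq:
  fixes B :: "real^'r^'j" and C :: "real^'r^'k"
  shows "khatri_rao_range B C = range (\<lambda>\<mu>. B ** diag_matrix \<mu> ** transpose C)"
proof -
  have "(\<Sum>r\<in>UNIV. \<mu> r *\<^sub>R outer (column r B) (column r C)) = B ** diag_matrix \<mu> ** transpose C"
    for \<mu> :: "'r \<Rightarrow> real"
    by (simp add: vec_eq_iff outer_def column_def matrix_matrix_mult_def transpose_def
        diag_matrix_def if_distrib cong: if_cong) (simp add: ac_simps)
  then show ?thesis by (simp add: khatri_rao_range_def)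
qed

lemma rank_factorization:
  fixes X :: "real^'k^'j"
  assumes "rank X \<le> CARD('r)"
  obtains B :: "real^'r^'j" and C :: "real^'r^'k" where "X = B ** transpose C"
proof -
  obtain S where S: "independent S" "columns X \<subseteq> span S" "card S = dim (columns X)"
    by (rule basis_exists[of "columns X"])
  then have "finite S" "card S \<le> CARD('r)"
    using assms by (auto simp: column_rank_def independent_imp_finite)
  then obtain g :: "(real^'j) \<Rightarrow> 'r" where g: "inj_on g S"
    using card_le_inj[of S "UNIV :: 'r set"] by auto
  \<comment> \<open>The basis \<open>S\<close> fills some of the columns of \<open>B\<close>; the entries of the others are arbitrary.\<close>
  define B :: "real^'r^'j" where "B = (\<chi> j r. inv_into S g r $ j)"
  have "v = column (g v) B" if "v \<in> S" for v
    using that g by (simp add: B_def column_def vec_eq_iff)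
  then have "S \<subseteq> range ((*v) B)"
    by (metis matrix_vector_mult_basis rangeI subsetI)
  moreover have "subspace (range ((*v) B))"
    by (intro linear_subspace_image subspace_UNIV matrix_vector_mul_linear)
  ultimately have "columns X \<subseteq> range ((*v) B)"
    using S(2) span_minimal by blast
  then have "\<forall>k. \<exists>y. column k X = B *v y"
    by (auto simp: columns_def)
  then obtain y where y: "\<And>k. column k X = B *v y k"
    by metis
  define C :: "real^'r^'k" where "C = (\<chi> k. y k)"
  have "X = B ** transpose C"
    using y by (simp add: C_def vec_eq_iff column_def matrix_vector_mult_def
        matrix_matrix_mult_def transpose_def)
  then show ?thesis by (rule that)
qed

lemma UN_khatri_rao_range:
  "(\<Union>(B, C)\<in>(UNIV :: ((real^'r^'j) \<times> (real^'r^'k)) set). khatri_rao_range B C)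
    = {X :: real^'k^'j. rank X \<le> CARD('r)}"
proof (intro equalityI subsetI)
  fix X :: "real^'k^'j"
  assume "X \<in> (\<Union>(B, C)\<in>(UNIV :: ((real^'r^'j) \<times> (real^'r^'k)) set). khatri_rao_range B C)"
  then obtain B :: "real^'r^'j" and C :: "real^'r^'k" and \<mu>
    where X: "X = B ** (diag_matrix \<mu> ** transpose C)"
    by (auto simp: khatri_rao_range_eq matrix_mul_assoc)
  have "rank X \<le> rank B"
    unfolding X by (rule rank_mul_le_left)
  also have "\<dots> \<le> CARD('r)"
    using rank_bound[of B] by simp
  finally show "X \<in> {X. rank X \<le> CARD('r)}" by simp
next
  fix X :: "real^'k^'j"
  assume "X \<in> {X. rank X \<le> CARD('r)}"
  then obtain B :: "real^'r^'j" and C :: "real^'r^'k" where "X = B ** transpose C"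
    using rank_factorization by blast
  moreover have "diag_matrix (\<lambda>r::'r. 1) = mat 1"
    by (simp add: diag_matrix_def mat_def)
  ultimately have "X = B ** diag_matrix (\<lambda>r. 1) ** transpose C"
    by simp
  then show "X \<in> (\<Union>(B, C)\<in>(UNIV :: ((real^'r^'j) \<times> (real^'r^'k)) set). khatri_rao_range B C)"
    by (auto simp: khatri_rao_range_eq)
qed

section \<open>Comparison of the infima\<close>

theorem corollary4p2:
  fixes T :: "real^'k^'j^'i"
    and V :: "real^('j \<times> 'k)^('j \<times> 'k)"
    and lam :: "'j \<times> 'k \<Rightarrow> real"
  assumes "orthogonal_matrix V"
    and "slice_gram T = V ** diag_matrix lam ** transpose V"
  shows "((INF (B, C) \<in> (UNIV :: ((real^'r^'j) \<times> (real^'r^'k)) set). cp_cost_red T B C)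
           \<le> (INF (B, C) \<in> (UNIV :: ((real^'r^'j) \<times> (real^'r^'k)) set). kr_cost lam V B C))
     \<and> ((INF (B, C) \<in> (UNIV :: ((real^'r^'j) \<times> (real^'r^'k)) set). kr_cost lam V B C)
           = (INF X \<in> {X :: real^'k^'j. rank X \<le> CARD('r)}. weighted_dist lam V X))"
proof
  let ?U = "UNIV :: ((real^'r^'j) \<times> (real^'r^'k)) set"
  have lower: "cp_cost_red T B C \<le> weighted_dist lam V X" if "X \<in> khatri_rao_range B C"
    for B :: "real^'r^'j" and C :: "real^'r^'k" and X
    using weighted_dist_eq_cp_cost[OF assms that] cp_cost_red_le by metis
  have nonempty: "khatri_rao_range B C \<noteq> {}" for B :: "real^'r^'j" and C :: "real^'r^'k"
    by (simp add: khatri_rao_range_def)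
  have "cp_cost_red T B C \<le> kr_cost lam V B C" for B :: "real^'r^'j" and C :: "real^'r^'k"
    unfolding kr_cost_def by (rule cINF_greatest[OF nonempty lower])
  moreover have "bdd_below ((\<lambda>(B, C). cp_cost_red T B C) ` ?U)"
    by (rule bdd_belowI[of _ 0]) (auto simp: cp_cost_red_nonneg)
  ultimately show "(INF (B, C) \<in> ?U. cp_cost_red T B C) \<le> (INF (B, C) \<in> ?U. kr_cost lam V B C)"
    by (intro cINF_mono) auto
  have "bdd_below (\<Union>p\<in>?U. weighted_dist lam V ` (case p of (B, C) \<Rightarrow> khatri_rao_range B C))"
    by (rule bdd_belowI[of _ 0]) (auto intro: order_trans[OF cp_cost_red_nonneg lower])
  then have "(INF X \<in> (\<Union>(B, C)\<in>?U. khatri_rao_range B C). weighted_dist lam V X)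
      = (INF p\<in>?U. INF X \<in> (case p of (B, C) \<Rightarrow> khatri_rao_range B C). weighted_dist lam V X)"
    by (intro cINF_UNION) (auto simp: nonempty)
  then show "(INF (B, C) \<in> ?U. kr_cost lam V B C)
      = (INF X \<in> {X :: real^'k^'j. rank X \<le> CARD('r)}. weighted_dist lam V X)"
    unfolding UN_khatri_rao_range by (simp only: kr_cost_def case_prod_beta')
qed

end
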